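(* Let $\mathbb{K}=\sum_{j=0}^{\infty}\frac{(-1)^{j}}{(2j+1)^{2}}$ be Catalan's constant. Then $$\mathbb{K}=\sum_{n=0}^{\infty}\frac{n!\,\bigl(H_{2n+1}-H_{n}/2\bigr)}{2\,(2n+1)!!},$$ where $H_n=\sum_{j=1}^n 1/j$ is the $n$-th harmonic number ($H_0=0$).
   Context: $(2n+1)!!=1\cdot3\cdot5\cdots(2n+1)$. *)

theory Defs
  imports "HOL-Analysis.Harmonic_Numbers"
begin

definition catalan_constant :: real
  where "catalan_constant = (\<Sum>j. (-1) ^ j / (2 * real j + 1)\<^sup>2)"

text \<open>The series converges, so \<^const>\<open>suminf\<close> denotes its limit.\<close>

lemma catalan_constant_sums:
  "(\<lambda>j. (-1) ^ j / (2 * real j + 1)\<^sup>2) sums catalan_constant"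
proof -
  have "summable (\<lambda>j. norm ((-1) ^ j / (2 * real j + 1)\<^sup>2))"
  proof (rule summable_comparison_test')
    show "summable (\<lambda>j. inverse ((real (Suc j)) ^ 2))"
      by (subst summable_Suc_iff) (simp add: inverse_power_summable)
  next
    fix j :: nat
    have "(real (Suc j)) ^ 2 \<le> (2 * real j + 1) ^ 2"
      by (rule power_mono) simp_all
    then have "inverse ((2 * real j + 1) ^ 2) \<le> inverse ((real (Suc j)) ^ 2)"
      by (rule le_imp_inverse_le) simp
    then show "norm (norm ((-1) ^ j / (2 * real j + 1)\<^sup>2)) \<le> inverse ((real (Suc j)) ^ 2)"
      by (simp add: abs_mult power_abs divide_inverse)
  qed
  then show ?thesis
    unfolding catalan_constant_def by (rule summable_sums[OF summable_norm_cancel])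
qed

text \<open>\<open>odd_double_fact n\<close> is $(2n+1)!!$, not $n!!$.\<close>

definition odd_double_fact :: "nat \<Rightarrow> nat"
  where "odd_double_fact n = (\<Prod>k\<le>n. 2 * k + 1)"

end

theory Submission
  imports Defs
begin

text \<open>The identity is Euler's series transformation
  $\sum_j (-1)^j a_j = \sum_n \nabla^n a_0 / 2^{n+1}$, where $\nabla a_j = a_j - a_{j+1}$,
  applied to $a_j = 1/(2j+1)^2$. The iterated differences have a closed form: differentiating
  $\nabla^n \frac{1}{x} = \frac{2^n n!}{x(x+2)\cdots(x+2n)}$ (step 2) with respect to $x$ gives
  $\nabla^n \frac{1}{x^2} = \frac{2^n n!}{x(x+2)\cdots(x+2n)} \sum_{k \le n} \frac{1}{x+2k}$.\<close>

text \<open>Each alternating sum \<open>S n\<close> of the row \<open>b n\<close> is the average of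
  \<open>b n 0\<close> and \<open>S (Suc n)\<close>. Iterating from \<open>S 0\<close> leaves the
  remainder \<open>S N / 2 ^ N\<close>. It vanishes because nonnegative differences make the rows
  decrease in \<open>n\<close>, so one bound serves all \<open>S N\<close>.\<close>

lemma euler_transform_sums:
  fixes b :: "nat \<Rightarrow> nat \<Rightarrow> real"
  assumes step: "\<And>n j. b (Suc n) j = b n j - b n (Suc j)"
    and nonneg: "\<And>n j. 0 \<le> b n j"
    and summable: "summable (b 0)"
  shows "(\<lambda>n. b n 0 / 2 ^ Suc n) sums (\<Sum>j. (-1) ^ j * b 0 j)"
proof -
  have le: "b n j \<le> b 0 j" for n j
  proof (induction n)
    case (Suc n)
    then show ?case using step[of n j] nonneg[of n "Suc j"] by linarith
  qed simp
  have summ: "summable (b n)" for n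
    by (rule summable_comparison_test'[OF summable, of 0]) (simp add: le nonneg)
  have alt: "summable (\<lambda>j. (-1) ^ j * b n j)" for n
    by (rule summable_comparison_test'[OF summ[of n], of 0]) (simp add: abs_mult nonneg)
  define S where "S n = (\<Sum>j. (-1) ^ j * b n j)" for n
  have S_Suc: "S (Suc n) = 2 * S n - b n 0" for n
  proof -
    have shift: "(\<lambda>j. (-1) ^ Suc j * b n (Suc j)) sums (S n - b n 0)"
      using sums_split_initial_segment[OF summable_sums[OF alt[of n]], of 1]
      by (simp add: S_def)
    \<comment> \<open>Adding the series to its own tail pairs \<open>b n j\<close> with
      \<open>- b n (Suc j)\<close> under a common sign, which produces the next row.\<close>
    have "(\<lambda>j. (-1) ^ j * b n j + (-1) ^ Suc j * b n (Suc j)) sums (S n + (S n - b n 0))"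
      unfolding S_def by (intro sums_add summable_sums alt shift[unfolded S_def])
    then have "(\<lambda>j. (-1) ^ j * b (Suc n) j) sums (2 * S n - b n 0)"
      by (simp add: step algebra_simps)
    then show ?thesis by (simp add: S_def sums_iff)
  qed
  \<comment> \<open>The terms telescope: each is
    \<open>S n / 2 ^ n - S (Suc n) / 2 ^ Suc n\<close>.\<close>
  have partial: "(\<Sum>n<N. b n 0 / 2 ^ Suc n) = S 0 - S N / 2 ^ N" for N
    by (induction N) (simp_all add: S_Suc field_simps)
  have bound: "\<bar>S n\<bar> \<le> suminf (b 0)" for n
  proof -
    have "\<bar>S n\<bar> \<le> (\<Sum>j. \<bar>(-1) ^ j * b n j\<bar>)"
      unfolding S_def by (rule summable_rabs) (simp add: abs_mult nonneg summ)
    also have "\<dots> = suminf (b n)" by (simp add: abs_mult nonneg)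
    also have "\<dots> \<le> suminf (b 0)" by (intro suminf_le le summ)
    finally show ?thesis .
  qed
  have "(\<lambda>N. S N / 2 ^ N) \<longlonglongrightarrow> 0"
  proof (rule Lim_null_comparison)
    show "\<forall>\<^sub>F N in sequentially. norm (S N / 2 ^ N) \<le> suminf (b 0) * (1 / 2) ^ N"
      using bound by (simp add: power_divide divide_right_mono)
    show "(\<lambda>N. suminf (b 0) * (1 / 2) ^ N) \<longlonglongrightarrow> (0::real)"
      by (intro tendsto_mult_right_zero LIMSEQ_power_zero) simp
  qed
  then have "(\<lambda>N. S 0 - S N / 2 ^ N) \<longlonglongrightarrow> S 0 - 0"
    by (intro tendsto_diff tendsto_const)
  then show ?thesis unfolding sums_def partial by (simp add: S_def)
qed

text \<open>Starting from the closed form makes nonnegativity evident and leaves only the difference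
  recurrence to check. The last factor is minus the logarithmic derivative in \<open>x\<close> of
  the quotient before it.\<close>

definition diff_inv_square :: "nat \<Rightarrow> real \<Rightarrow> real"
  where "diff_inv_square n x =
    2 ^ n * fact n / (\<Prod>k\<le>n. x + 2 * real k) * (\<Sum>k\<le>n. 1 / (x + 2 * real k))"

lemma diff_inv_square_0: "diff_inv_square 0 x = 1 / x\<^sup>2"
  by (simp add: diff_inv_square_def power2_eq_square)

lemma diff_inv_square_nonneg: "0 < x \<Longrightarrow> 0 \<le> diff_inv_square n x"
  unfolding diff_inv_square_def
  by (intro mult_nonneg_nonneg divide_nonneg_nonneg prod_nonneg sum_nonneg) auto

text \<open>The factors at \<open>x\<close> and at \<open>x + 2\<close> agree except for the first
  one, \<open>x\<close>, and the last one, \<open>M\<close>. With the shared part collected in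
  \<open>D\<close> and \<open>c\<close>, a rational identity in \<open>x\<close>, \<open>M\<close>,
  \<open>D\<close>, \<open>c\<close> remains.\<close>

lemma diff_inv_square_Suc:
  assumes "0 < x"
  shows "diff_inv_square (Suc n) x = diff_inv_square n x - diff_inv_square n (x + 2)"
proof -
  define D where "D = (\<Prod>k<n. x + 2 + 2 * real k)"
  define c where "c = (\<Sum>k<n. 1 / (x + 2 + 2 * real k))"
  define M where "M = x + 2 + 2 * real n"
  have pos: "M > 0" "D > 0" using assms unfolding M_def D_def by (auto intro!: prod_pos)
  have arg: "x + 2 * real (Suc k) = x + 2 + 2 * real k" for k by simp
  have left: "(\<Prod>k\<le>n. x + 2 * real k) = x * D" "(\<Sum>k\<le>n. 1 / (x + 2 * real k)) = 1 / x + c"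
    unfolding D_def c_def lessThan_Suc_atMost[symmetric] prod.lessThan_Suc_shift
      sum.lessThan_Suc_shift arg by simp_all
  have right: "(\<Prod>k\<le>n. x + 2 + 2 * real k) = D * M"
      "(\<Sum>k\<le>n. 1 / (x + 2 + 2 * real k)) = c + 1 / M"
    unfolding D_def c_def M_def lessThan_Suc_atMost[symmetric] by simp_all
  have both: "(\<Prod>k\<le>Suc n. x + 2 * real k) = x * D * M"
      "(\<Sum>k\<le>Suc n. 1 / (x + 2 * real k)) = 1 / x + c + 1 / M"
    unfolding prod.atMost_Suc sum.atMost_Suc left arg M_def by simp_all
  \<comment> \<open>The factor gained by \<open>2 ^ n * fact n\<close> is the gap between the
    extreme factors. It matches the right side since M/x - x/M = (M - x)(1/x + 1/M).\<close>
  have M: "2 * (real n + 1) = M - x" by (simp add: M_def)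
  have "diff_inv_square (Suc n) x
      = 2 ^ n * fact n * (2 * (real n + 1)) / (x * D * M) * (1 / x + c + 1 / M)"
    unfolding diff_inv_square_def both by (simp add: mult_ac)
  also have "\<dots> = 2 ^ n * fact n / (x * D) * (1 / x + c) - 2 ^ n * fact n / (D * M) * (c + 1 / M)"
    unfolding M using pos assms by (simp add: field_simps)
  finally show ?thesis unfolding diff_inv_square_def left right .
qed

text \<open>Half of \<open>harm n\<close> collects the reciprocals of the even numbers up to 2n, so
  only odd denominators survive.\<close>

lemma harm_odd: "harm (2 * n + 1) - harm n / 2 = (\<Sum>k\<le>n. 1 / (1 + 2 * real k))"
proof (induction n)
  case (Suc n)
  have "harm (2 * Suc n + 1) = harm (2 * n + 1) + 1 / (2 * (real n + 1)) + 1 / (2 * real n + 3)"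
    by (simp add: harm_Suc inverse_eq_divide add_ac)
  moreover have "harm (Suc n) / 2 = harm n / 2 + 1 / (2 * (real n + 1))"
    by (simp add: harm_Suc inverse_eq_divide add_divide_distrib add_ac)
  moreover have
    "(\<Sum>k\<le>Suc n. 1 / (1 + 2 * real k)) = (\<Sum>k\<le>n. 1 / (1 + 2 * real k)) + 1 / (2 * real n + 3)"
    by (simp add: add_ac)
  ultimately show ?case using Suc by linarith
qed (simp add: harm_expand)

theorem theorem1:
  shows "(\<lambda>n. fact n * (harm (2 * n + 1) - harm n / 2) / (2 * real (odd_double_fact n)))
           sums catalan_constant"
proof -
  \<comment> \<open>Sampling at odd numbers turns step 2 in \<open>x\<close> into step 1 in
    \<open>j\<close>.\<close>
  define b where "b n j = diff_inv_square n (2 * real j + 1)" for n j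
  have "(\<lambda>n. b n 0 / 2 ^ Suc n) sums (\<Sum>j. (-1) ^ j * b 0 j)"
  proof (rule euler_transform_sums)
    show "b (Suc n) j = b n j - b n (Suc j)" for n j
      using diff_inv_square_Suc[of "2 * real j + 1" n] by (simp add: b_def add_ac)
    show "0 \<le> b n j" for n j
      by (simp add: b_def diff_inv_square_nonneg)
    have "summable (\<lambda>j. 1 / real (Suc j) ^ 2)"
      by (subst summable_Suc_iff) (use inverse_power_summable[of 2, where 'a = real] in
          \<open>simp add: inverse_eq_divide\<close>)
    then show "summable (b 0)"
    proof (rule summable_comparison_test'[of _ 0])
      show "norm (b 0 j) \<le> 1 / real (Suc j) ^ 2" for j
        by (auto simp: b_def diff_inv_square_0 intro!: divide_left_mono power_mono)
    qed
  qed
  \<comment> \<open>At x = 1 the product is (2n+1)!!, and \<open>2 ^ n\<close> cancels against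
    \<open>2 ^ Suc n\<close>, leaving the 2 in the denominator.\<close>
  moreover have "b n 0 / 2 ^ Suc n
      = fact n * (harm (2 * n + 1) - harm n / 2) / (2 * real (odd_double_fact n))" for n
    unfolding harm_odd by (simp add: b_def diff_inv_square_def odd_double_fact_def add_ac)
  ultimately show ?thesis
    by (simp add: catalan_constant_def b_def diff_inv_square_0)
qed

end
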